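(* Let $(A,\searrow,\nearrow,\nwarrow,\swarrow)$ be an L-quadri-algebra. (1) The products $x\succ y=x\searrow y+x\nearrow y$ and $x\prec y=x\nwarrow y+x\swarrow y$ ($x,y\in A$) define an L-dendriform algebra $(A,\succ,\prec)$ (called the associated vertical L-dendriform algebra). (2) The products $x\vee y=x\searrow y+x\swarrow y$ and $x\wedge y=x\nearrow y+x\nwarrow y$ ($x,y\in A$) define an L-dendriform algebra $(A,\vee,\wedge)$ (called the associated depth L-dendriform algebra). (3) The products $x\triangleright y=x\searrow y-y\nwarrow x$ and $x\triangleleft y=x\nearrow y-y\swarrow x$ ($x,y\in A$) define an L-dendriform algebra $(A,\triangleright,\triangleleft)$ (called the associated horizontal L-dendriform algebra).
   Context: All algebras are finite-dimensional over a field of characteristic zero. An L-dendriform algebra $(A,\triangleright,\triangleleft)$ is a vector space $A$ with two bilinear products such that for all $x,y,z\in A$: $x\triangleright(y\triangleright z)-(x\bullet y)\triangleright z=y\triangleright(x\triangleright z)-(y\bullet x)\triangleright z$ and $x\triangleright(y\triangleleft z)-(x\triangleright y)\triangleleft z=y\triangleleft(x\bullet z)-(y\triangleleft x)\triangleleft z$, where $x\bullet y=x\triangleright y+x\triangleleft y$. (For $(A,\succ,\prec)$ or $(A,\vee,\wedge)$ the first listed product plays the role of $\triangleright$ and the second that of $\triangleleft$.) An L-quadri-algebra $(A,\searrow,\nearrow,\nwarrow,\swarrow)$ is a vector space with four bilinear products such that for all $x,y,z\in A$: $x\searrow(y\searrow z)-(x\ast y)\searrow z=y\searrow(x\searrow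 z)-(y\ast x)\searrow z$; $x\searrow(y\nearrow z)-(x\vee y)\nearrow z=y\nearrow(x\succ z)-(y\wedge x)\nearrow z$; $x\searrow(y\nwarrow z)-(x\searrow y)\nwarrow z=y\nwarrow(x\ast z)-(y\nwarrow x)\nwarrow z$; $x\nearrow(y\prec z)-(x\nearrow y)\nwarrow z=y\swarrow(x\wedge z)-(y\swarrow x)\nwarrow z$; $x\searrow(y\swarrow z)-(x\succ y)\swarrow z=y\swarrow(x\vee z)-(y\prec x)\swarrow z$; where $x\succ y=x\searrow y+x\nearrow y$, $x\prec y=x\nwarrow y+x\swarrow y$, $x\vee y=x\searrow y+x\swarrow y$, $x\wedge y=x\nearrow y+x\nwarrow y$, $x\ast y=x\searrow y+x\nearrow y+x\nwarrow y+x\swarrow y$. *)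

theory Defs
  imports Complex_Main
begin

text \<open>
  The carrier of an algebra is an entire type \<open>'a\<close>, made into a vector space over a field \<open>'k\<close> of
  characteristic zero by \<open>scale\<close>. Finite-dimensionality and the characteristic are standing
  assumptions, hence part of every notion of algebra below.
\<close>

locale fin_dim_space = vector_space scale
  for scale :: "'k::field_char_0 \<Rightarrow> 'a::ab_group_add \<Rightarrow> 'a" +
  assumes finite_dimensional: "\<exists>Basis. finite_dimensional_vector_space scale Basis"
begin

definition bilinear_product :: "('a \<Rightarrow> 'a \<Rightarrow> 'a) \<Rightarrow> bool" where
  "bilinear_product p \<longleftrightarrow>
     (\<forall>x. Vector_Spaces.linear scale scale (\<lambda>y. p x y)) \<and>
     (\<forall>y. Vector_Spaces.linear scale scale (\<lambda>x. p x y))"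

end

locale dendriform_products = fin_dim_space scale
  for scale :: "'k::field_char_0 \<Rightarrow> 'a::ab_group_add \<Rightarrow> 'a" +
  fixes tright :: "'a \<Rightarrow> 'a \<Rightarrow> 'a" (infixl "\<triangleright>" 70)
    and tleft :: "'a \<Rightarrow> 'a \<Rightarrow> 'a" (infixl "\<triangleleft>" 70)
  assumes bilinear_tright: "bilinear_product (\<triangleright>)"
    and bilinear_tleft: "bilinear_product (\<triangleleft>)"
begin

abbreviation bullet :: "'a \<Rightarrow> 'a \<Rightarrow> 'a" (infixl "\<bullet>" 70)
  where "x \<bullet> y \<equiv> x \<triangleright> y + x \<triangleleft> y"

end

locale L_dendriform_algebra = dendriform_products +
  assumes L_dendriform1:
    "x \<triangleright> (y \<triangleright> z) - (x \<bullet> y) \<triangleright> z = y \<triangleright> (x \<triangleright> z) - (y \<bullet> x) \<triangleright> z"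
    and L_dendriform2:
    "x \<triangleright> (y \<triangleleft> z) - (x \<triangleright> y) \<triangleleft> z = y \<triangleleft> (x \<bullet> z) - (y \<triangleleft> x) \<triangleleft> z"

locale quadri_products = fin_dim_space scale
  for scale :: "'k::field_char_0 \<Rightarrow> 'a::ab_group_add \<Rightarrow> 'a" +
  fixes se :: "'a \<Rightarrow> 'a \<Rightarrow> 'a" (infixl "\<searrow>" 70)
    and ne :: "'a \<Rightarrow> 'a \<Rightarrow> 'a" (infixl "\<nearrow>" 70)
    and nw :: "'a \<Rightarrow> 'a \<Rightarrow> 'a" (infixl "\<nwarrow>" 70)
    and sw :: "'a \<Rightarrow> 'a \<Rightarrow> 'a" (infixl "\<swarrow>" 70)
  assumes bilinear_se: "bilinear_product (\<searrow>)"
    and bilinear_ne: "bilinear_product (\<nearrow>)"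
    and bilinear_nw: "bilinear_product (\<nwarrow>)"
    and bilinear_sw: "bilinear_product (\<swarrow>)"
begin

abbreviation succ_prod :: "'a \<Rightarrow> 'a \<Rightarrow> 'a" (infixl "\<succ>" 70)
  where "x \<succ> y \<equiv> x \<searrow> y + x \<nearrow> y"

abbreviation prec_prod :: "'a \<Rightarrow> 'a \<Rightarrow> 'a" (infixl "\<prec>" 70)
  where "x \<prec> y \<equiv> x \<nwarrow> y + x \<swarrow> y"

abbreviation vee_prod :: "'a \<Rightarrow> 'a \<Rightarrow> 'a" (infixl "\<^bold>\<or>" 70)
  where "x \<^bold>\<or> y \<equiv> x \<searrow> y + x \<swarrow> y"

abbreviation wedge_prod :: "'a \<Rightarrow> 'a \<Rightarrow> 'a" (infixl "\<^bold>\<and>" 70)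
  where "x \<^bold>\<and> y \<equiv> x \<nearrow> y + x \<nwarrow> y"

abbreviation ast_prod :: "'a \<Rightarrow> 'a \<Rightarrow> 'a" (infixl "\<^bold>*" 70)
  where "x \<^bold>* y \<equiv> x \<searrow> y + x \<nearrow> y + x \<nwarrow> y + x \<swarrow> y"

end

locale L_quadri_algebra = quadri_products +
  assumes L_quadri1:
    "x \<searrow> (y \<searrow> z) - (x \<^bold>* y) \<searrow> z = y \<searrow> (x \<searrow> z) - (y \<^bold>* x) \<searrow> z"
    and L_quadri2:
    "x \<searrow> (y \<nearrow> z) - (x \<^bold>\<or> y) \<nearrow> z = y \<nearrow> (x \<succ> z) - (y \<^bold>\<and> x) \<nearrow> z"
    and L_quadri3:
    "x \<searrow> (y \<nwarrow> z) - (x \<searrow> y) \<nwarrow> z = y \<nwarrow> (x \<^bold>* z) - (y \<nwarrow> x) \<nwarrow> z"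
    and L_quadri4:
    "x \<nearrow> (y \<prec> z) - (x \<nearrow> y) \<nwarrow> z = y \<swarrow> (x \<^bold>\<and> z) - (y \<swarrow> x) \<nwarrow> z"
    and L_quadri5:
    "x \<searrow> (y \<swarrow> z) - (x \<succ> y) \<swarrow> z = y \<swarrow> (x \<^bold>\<or> z) - (y \<prec> x) \<swarrow> z"

end

theory Submission
  imports Defs
begin

context fin_dim_space
begin

lemma bilinear_product_iff:
  "bilinear_product p \<longleftrightarrow>
     (\<forall>x y z. p x (y + z) = p x y + p x z) \<and> (\<forall>x y z. p (x + y) z = p x z + p y z) \<and>
     (\<forall>c x y. p x (scale c y) = scale c (p x y)) \<and> (\<forall>c x y. p (scale c x) y = scale c (p x y))"
  unfolding bilinear_product_def Vector_Spaces.linear_iff using vector_space_axioms by blast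

lemma bilinear_product_add_right: "bilinear_product p \<Longrightarrow> p x (y + z) = p x y + p x z"
  and bilinear_product_add_left: "bilinear_product p \<Longrightarrow> p (x + y) z = p x z + p y z"
  by (simp_all add: bilinear_product_iff)

lemma bilinear_product_diff_right: "bilinear_product p \<Longrightarrow> p x (y - z) = p x y - p x z"
  by (metis bilinear_product_add_right add_diff_cancel_right' diff_add_cancel)

lemma bilinear_product_diff_left: "bilinear_product p \<Longrightarrow> p (x - y) z = p x z - p y z"
  by (metis bilinear_product_add_left add_diff_cancel_right' diff_add_cancel)

lemma bilinear_product_add:
  "bilinear_product p \<Longrightarrow> bilinear_product q \<Longrightarrow> bilinear_product (\<lambda>x y. p x y + q x y)"
  by (simp add: bilinear_product_iff scale_right_distrib algebra_simps)

lemma bilinear_product_diff_flip: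
  "bilinear_product p \<Longrightarrow> bilinear_product q \<Longrightarrow> bilinear_product (\<lambda>x y. p x y - q y x)"
  by (simp add: bilinear_product_iff scale_right_diff_distrib algebra_simps)

end

context L_quadri_algebra
begin

text \<open>With these rules every identity below reduces to abelian-group arithmetic on triple
  products; the differences are needed for the horizontal products.\<close>

lemmas bilinear_expand =
  bilinear_product_add_right[OF bilinear_se] bilinear_product_add_left[OF bilinear_se]
  bilinear_product_add_right[OF bilinear_ne] bilinear_product_add_left[OF bilinear_ne]
  bilinear_product_add_right[OF bilinear_nw] bilinear_product_add_left[OF bilinear_nw]
  bilinear_product_add_right[OF bilinear_sw] bilinear_product_add_left[OF bilinear_sw]
  bilinear_product_diff_right[OF bilinear_se] bilinear_product_diff_left[OF bilinear_se]
  bilinear_product_diff_right[OF bilinear_ne] bilinear_product_diff_left[OF bilinear_ne]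
  bilinear_product_diff_right[OF bilinear_nw] bilinear_product_diff_left[OF bilinear_nw]
  bilinear_product_diff_right[OF bilinear_sw] bilinear_product_diff_left[OF bilinear_sw]

theorem vertical_L_dendriform: "L_dendriform_algebra scale (\<succ>) (\<prec>)"
proof unfold_locales
  show "bilinear_product (\<succ>)" "bilinear_product (\<prec>)"
    by (intro bilinear_product_add bilinear_se bilinear_ne bilinear_nw bilinear_sw)+
  fix x y z
  show "x \<succ> (y \<succ> z) - (x \<succ> y + x \<prec> y) \<succ> z = y \<succ> (x \<succ> z) - (y \<succ> x + y \<prec> x) \<succ> z"
    \<comment> \<open>The goal is invariant under exchanging x and y, but \<open>L_quadri2\<close>
      is not; its swapped, reversed copy supplies x \<nearrow> (y \<succ> z) on the left.\<close>
    using arg_cong2[OF L_quadri1[of x y z]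
        arg_cong2[OF L_quadri2[of x y z] L_quadri2[of y x z, symmetric], of "(+)"], of "(+)"]
    by (simp add: bilinear_expand algebra_simps)
  show "x \<succ> (y \<prec> z) - (x \<succ> y) \<prec> z = y \<prec> (x \<succ> z + x \<prec> z) - (y \<prec> x) \<prec> z"
    \<comment> \<open>The (x \<succ> y) \<prec> z term is split among the three: (x \<searrow> y)
      \<nwarrow> z, (x \<nearrow> y) \<nwarrow> z and (x \<succ> y) \<swarrow> z.\<close>
    using arg_cong2[OF L_quadri3[of x y z]
        arg_cong2[OF L_quadri4[of x y z] L_quadri5[of x y z], of "(+)"], of "(+)"]
    by (simp add: bilinear_expand algebra_simps)
qed

theorem depth_L_dendriform: "L_dendriform_algebra scale (\<^bold>\<or>) (\<^bold>\<and>)"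
proof unfold_locales
  show "bilinear_product (\<^bold>\<or>)" "bilinear_product (\<^bold>\<and>)"
    by (intro bilinear_product_add bilinear_se bilinear_ne bilinear_nw bilinear_sw)+
  fix x y z
  show "x \<^bold>\<or> (y \<^bold>\<or> z) - (x \<^bold>\<or> y + x \<^bold>\<and> y) \<^bold>\<or> z = y \<^bold>\<or> (x \<^bold>\<or> z) - (y \<^bold>\<or> x + y \<^bold>\<and> x) \<^bold>\<or> z"
    \<comment> \<open>As in the vertical case, with \<open>L_quadri5\<close> now symmetrised in x
      and y.\<close>
    using arg_cong2[OF L_quadri1[of x y z]
        arg_cong2[OF L_quadri5[of x y z] L_quadri5[of y x z, symmetric], of "(+)"], of "(+)"]
    by (simp add: bilinear_expand algebra_simps)
  show "x \<^bold>\<or> (y \<^bold>\<and> z) - (x \<^bold>\<or> y) \<^bold>\<and> z = y \<^bold>\<and> (x \<^bold>\<or> z + x \<^bold>\<and> z) - (y \<^bold>\<and> x) \<^bold>\<and> z"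
    \<comment> \<open>\<open>L_quadri4\<close> is swapped and reversed because here \<swarrow>
      belongs to the first product and \<nearrow> to the second.\<close>
    using arg_cong2[OF L_quadri2[of x y z]
        arg_cong2[OF L_quadri3[of x y z] L_quadri4[of y x z, symmetric], of "(+)"], of "(+)"]
    by (simp add: bilinear_expand algebra_simps)
qed

text \<open>Flipping the arguments of \<nwarrow> turns its right multiplications into left ones, up
  to sign. Here \<open>'b\<close> is the carrier.\<close>

abbreviation horizontal_right :: "'b \<Rightarrow> 'b \<Rightarrow> 'b" (infixl "\<triangleright>" 70)
  where "x \<triangleright> y \<equiv> x \<searrow> y - y \<nwarrow> x"

abbreviation horizontal_left :: "'b \<Rightarrow> 'b \<Rightarrow> 'b" (infixl "\<triangleleft>" 70)
  where "x \<triangleleft> y \<equiv> x \<nearrow> y - y \<swarrow> x"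

theorem horizontal_L_dendriform: "L_dendriform_algebra scale (\<triangleright>) (\<triangleleft>)"
proof unfold_locales
  show "bilinear_product (\<triangleright>)" "bilinear_product (\<triangleleft>)"
    by (intro bilinear_product_diff_flip bilinear_se bilinear_ne bilinear_nw bilinear_sw)+
  fix x y z
  show "x \<triangleright> (y \<triangleright> z) - (x \<triangleright> y + x \<triangleleft> y) \<triangleright> z = y \<triangleright> (x \<triangleright> z) - (y \<triangleright> x + y \<triangleleft> x) \<triangleright> z"
    \<comment> \<open>The flipped terms keep z to the left of x or y, so \<open>L_quadri3\<close> is
      used with z in its middle slot; the equality of commutators handles both \<searrow> z and z
      \<nwarrow>.\<close>
    using arg_cong2[OF L_quadri1[of x y z]
        arg_cong2[OF L_quadri3[of y z x] L_quadri3[of x z y, symmetric], of "(+)"], of "(+)"]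
    by (simp add: bilinear_expand algebra_simps)
  show "x \<triangleright> (y \<triangleleft> z) - (x \<triangleright> y) \<triangleleft> z = y \<triangleleft> (x \<triangleright> z + x \<triangleleft> z) - (y \<triangleleft> x) \<triangleleft> z"
    \<comment> \<open>Again z is the middle argument for the flipped terms: \<open>L_quadri4\<close>
      gives those ending in \<nwarrow> x, \<open>L_quadri5\<close> those ending in \<swarrow>
      y.\<close>
    using arg_cong2[OF L_quadri2[of x y z]
        arg_cong2[OF L_quadri4[of y z x] L_quadri5[of x z y, symmetric], of "(+)"], of "(+)"]
    by (simp add: bilinear_expand algebra_simps)
qed

end

theorem proposition3p3:
  fixes scale :: "'k::field_char_0 \<Rightarrow> 'a::ab_group_add \<Rightarrow> 'a"
    and se ne nw sw :: "'a \<Rightarrow> 'a \<Rightarrow> 'a"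
  assumes "L_quadri_algebra scale se ne nw sw"
  shows "L_dendriform_algebra scale (\<lambda>x y. se x y + ne x y) (\<lambda>x y. nw x y + sw x y) \<and>
         L_dendriform_algebra scale (\<lambda>x y. se x y + sw x y) (\<lambda>x y. ne x y + nw x y) \<and>
         L_dendriform_algebra scale (\<lambda>x y. se x y - nw y x) (\<lambda>x y. ne x y - sw y x)"
  using L_quadri_algebra.vertical_L_dendriform[OF assms]
    L_quadri_algebra.depth_L_dendriform[OF assms]
    L_quadri_algebra.horizontal_L_dendriform[OF assms]
  by blast

end
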